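(* Let $\triangle_j:=\min_{1\le i\le n}\{h_i-h_{ij}\}$ for $j=1,\dots,n$. For $r\ge 0$ let $P_r$ be the $n\times n$ matrix whose $(v,i)$ entry is $\widetilde\Lambda_{v,i}(r+\triangle_i+1,\,r+h_v+1)$, assume $P_r$ is invertible, and let $d_{ij}$ (depending on $r$) denote the entries of $D:=P_r^{-1}$. Set $\mathbf Q_i^j(t)=\mathbf 0$ and $\mathbf R_i^j(t)=-t^{j\sigma}\mathbf e_i$ for $j\in S_i=\{0,\dots,h_i-1\}$, $i=1,\dots,n$. Then the recursion $$\mathbf Q_j^{h_j+r}(t)=\sum_{i=1}^n d_{ij}\Big(t^{(r+\triangle_i)\sigma}\mathbf e_i-\sum_{v=1}^n\sum_{l=1}^{r+h_v}\widetilde\Lambda_{v,i}(r+\triangle_i+1,l)\,\mathbf Q_v^{l-1}(t)\Big),$$ $$\mathbf R_j^{h_j+r}(t)=-\sum_{i=1}^n d_{ij}\Big(\sum_{v=1}^n\sum_{l=1}^{r+h_v}\widetilde\Lambda_{v,i}(r+\triangle_i+1,l)\,\mathbf R_v^{l-1}(t)\Big),\qquad j=1,\dots,n,\ r=0,1,2,\dots,$$ generates fractional vector canonical polynomials of $L$ and their associated vector residual polynomials, i.e. $$L\big(\mathbf Q_j^{h_j+r}(t)\big)=t^{(h_j+r)\sigma}\mathbf e_j+\mathbf R_j^{h_j+r}(t)\qquad\text{for all } j=1,\dots,n,\ r=0,1,2,\dots .$$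
   Context: Let $\alpha_{ij}=a_{ij}/b_{ij}\in\mathbb{Q}\cap(0,1]$ in lowest terms ($i,j=1,\dots,n$), $\gamma$ the least common multiple of all $b_{ij}$, $\sigma=1/\gamma$, $\delta_{ij}=\gamma\alpha_{ij}\in\mathbb{N}$. The kernels are taken as finite expansions $k_{ij}(t,s)=\sum_{p,q=0}^N\widehat k^{ij}_{p,q}t^{p\sigma}s^{q\sigma}$ with real coefficients. For a vector function $Y=(y_1,\dots,y_n)^T$ on $[0,1]$, $$LY(t)=Y(t)-\int_0^tK(t,s)Y(s)\,ds,\qquad K(t,s)=\big[(t-s)^{\alpha_{ij}-1}k_{ij}(t,s)\big]_{i,j=1}^n .$$ $\mathbf e_i$ are the standard unit vectors of $\mathbb{R}^n$. A vector polynomial means a vector whose components are polynomials in $t^\sigma$. A vector polynomial $\mathbf Q_i^j$ is a fractional vector canonical polynomial of $L$, with vector residual polynomial $\mathbf R_i^j$, if $L(\mathbf Q_i^j(t))=t^{j\sigma}\mathbf e_i+\mathbf R_i^j(t)$, for $j\in\mathbb{N}_0\setminus S_i$. The infinite matrix $\Lambda_{ij}$ (rows and columns indexed from $1$) has, in row $l+1$ ($l\ge0$), the entry $$\widetilde k^{ij}_{v,l}=\sum_{0\le p,q\le N,\ p+q=v}\widehat k^{ij}_{p,q}\,\beta\big(\delta_{ij}\sigma,(q+l)\sigma+1\big)$$ in column $\delta_{ij}+l+v+1$ for $0\le v\le 2N$, and zeros elsewhere; $\beta$ is the Euler Beta function. $h_{ij}$ is the index of the highest nonzero diagonal of $\Lambda_{ij}$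 above the main diagonal (the main diagonal having index $0$; $h_{ij}=0$ if $\Lambda_{ij}=0$), and $h_i=\max_{1\le j\le n}h_{ij}$. Moreover $\widetilde\Lambda_{ii}=\mathbf I-\Lambda_{ii}$ and $\widetilde\Lambda_{i\ell}=-\Lambda_{i\ell}$ for $i\neq\ell$, where $\mathbf I$ is the infinite identity matrix, and $\widetilde\Lambda_{i,j}(r,l)$ denotes the $(r,l)$ entry of $\widetilde\Lambda_{ij}$. Empty sums are zero. *)

theory Defs
  imports "HOL-Analysis.Analysis"
begin

text \<open>
  The system has size \<open>CARD('n)\<close>. Its data are the exponents \<open>\<alpha>\<^sub>i\<^sub>j = a i j / b i j\<close>,
  the degree bound \<open>N\<close> and the kernel coefficients \<open>\<kappa> i j p q\<close>.
\<close>

definition gam :: "('n \<Rightarrow> 'n \<Rightarrow> nat) \<Rightarrow> nat" where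
  "gam b = Lcm {b i j | i j. True}"

definition sig :: "('n \<Rightarrow> 'n \<Rightarrow> nat) \<Rightarrow> real" where
  "sig b = 1 / real (gam b)"

text \<open>This is \<open>\<gamma> \<alpha>\<^sub>i\<^sub>j\<close>; the division is exact because \<open>b i j\<close> divides \<open>gam b\<close>.\<close>
definition delta :: "('n \<Rightarrow> 'n \<Rightarrow> nat) \<Rightarrow> ('n \<Rightarrow> 'n \<Rightarrow> nat) \<Rightarrow> 'n \<Rightarrow> 'n \<Rightarrow> nat" where
  "delta a b i j = gam b * a i j div b i j"

text \<open>
  The power \<open>t\<^bsup>m\<sigma>\<^esup>\<close> for \<open>t \<ge> 0\<close>. It is not written \<open>t powr (m * \<sigma>)\<close> because
  \<open>0 powr 0 = 0\<close>, whereas \<open>t\<^bsup>0\<^esup>\<close> has to be the constant \<open>1\<close> on all of \<open>[0,1]\<close>.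
\<close>
definition fpow :: "('n \<Rightarrow> 'n \<Rightarrow> nat) \<Rightarrow> nat \<Rightarrow> real \<Rightarrow> real" where
  "fpow b m t = (t powr sig b) ^ m"

definition vector_polynomial ::
    "('n \<Rightarrow> 'n \<Rightarrow> nat) \<Rightarrow> (real \<Rightarrow> real ^ 'n) \<Rightarrow> bool" where
  "vector_polynomial b Y \<longleftrightarrow>
     (\<exists>p :: 'n \<Rightarrow> real poly. \<forall>t\<in>{0..1}. \<forall>i. Y t $ i = poly (p i) (t powr sig b))"

definition ker ::
    "('n \<Rightarrow> 'n \<Rightarrow> nat) \<Rightarrow> nat \<Rightarrow> ('n \<Rightarrow> 'n \<Rightarrow> nat \<Rightarrow> nat \<Rightarrow> real) \<Rightarrow>
     'n \<Rightarrow> 'n \<Rightarrow> real \<Rightarrow> real \<Rightarrow> real" where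
  "ker b N \<kappa> i j t s = (\<Sum>p\<le>N. \<Sum>q\<le>N. \<kappa> i j p q * fpow b p t * fpow b q s)"

definition Kmat ::
    "('n \<Rightarrow> 'n \<Rightarrow> nat) \<Rightarrow> ('n \<Rightarrow> 'n \<Rightarrow> nat) \<Rightarrow> nat \<Rightarrow>
     ('n \<Rightarrow> 'n \<Rightarrow> nat \<Rightarrow> nat \<Rightarrow> real) \<Rightarrow> real \<Rightarrow> real \<Rightarrow> real ^ 'n ^ 'n" where
  "Kmat a b N \<kappa> t s =
     (\<chi> i j. (t - s) powr (real (a i j) / real (b i j) - 1) * ker b N \<kappa> i j t s)"

definition Lop ::
    "('n::finite \<Rightarrow> 'n \<Rightarrow> nat) \<Rightarrow> ('n \<Rightarrow> 'n \<Rightarrow> nat) \<Rightarrow> nat \<Rightarrow>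
     ('n \<Rightarrow> 'n \<Rightarrow> nat \<Rightarrow> nat \<Rightarrow> real) \<Rightarrow> (real \<Rightarrow> real ^ 'n) \<Rightarrow> real \<Rightarrow> real ^ 'n" where
  "Lop a b N \<kappa> Y t = Y t - integral {0..t} (\<lambda>s. Kmat a b N \<kappa> t s *v Y s)"

definition ktil ::
    "('n \<Rightarrow> 'n \<Rightarrow> nat) \<Rightarrow> ('n \<Rightarrow> 'n \<Rightarrow> nat) \<Rightarrow> nat \<Rightarrow>
     ('n \<Rightarrow> 'n \<Rightarrow> nat \<Rightarrow> nat \<Rightarrow> real) \<Rightarrow> 'n \<Rightarrow> 'n \<Rightarrow> nat \<Rightarrow> nat \<Rightarrow> real" where
  "ktil a b N \<kappa> i j v l =
     (\<Sum>(p, q)\<in>{(p, q). p \<le> N \<and> q \<le> N \<and> p + q = v}.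
        \<kappa> i j p q * Beta (real (delta a b i j) * sig b) (real (q + l) * sig b + 1))"

text \<open>
  Infinite matrices are functions of type \<open>nat \<Rightarrow> nat \<Rightarrow> real\<close> used at indices from \<open>1\<close> on.
  Row \<open>r = l + 1\<close> carries the coefficient with index \<open>v\<close> in column
  \<open>c = delta + l + v + 1 = delta + r + v\<close>.
\<close>
definition Lam ::
    "('n \<Rightarrow> 'n \<Rightarrow> nat) \<Rightarrow> ('n \<Rightarrow> 'n \<Rightarrow> nat) \<Rightarrow> nat \<Rightarrow>
     ('n \<Rightarrow> 'n \<Rightarrow> nat \<Rightarrow> nat \<Rightarrow> real) \<Rightarrow> 'n \<Rightarrow> 'n \<Rightarrow> nat \<Rightarrow> nat \<Rightarrow> real" where
  "Lam a b N \<kappa> i j r c =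
     (if 1 \<le> r \<and> delta a b i j + r \<le> c \<and> c \<le> delta a b i j + r + 2 * N
      then ktil a b N \<kappa> i j (c - (delta a b i j + r)) (r - 1) else 0)"

definition LamT ::
    "('n \<Rightarrow> 'n \<Rightarrow> nat) \<Rightarrow> ('n \<Rightarrow> 'n \<Rightarrow> nat) \<Rightarrow> nat \<Rightarrow>
     ('n \<Rightarrow> 'n \<Rightarrow> nat \<Rightarrow> nat \<Rightarrow> real) \<Rightarrow> 'n \<Rightarrow> 'n \<Rightarrow> nat \<Rightarrow> nat \<Rightarrow> real" where
  "LamT a b N \<kappa> i j r c =
     (if i = j then (if r = c then 1 else 0) - Lam a b N \<kappa> i i r c
      else - Lam a b N \<kappa> i j r c)"

text \<open>
  Index of the highest diagonal \<open>d \<ge> 1\<close> having a nonzero entry. The set is finite for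
  \<open>M = Lam a b N \<kappa> i j\<close>, and inserting \<open>0\<close> gives the convention for \<open>M = 0\<close>.
\<close>
definition highest_diag :: "(nat \<Rightarrow> nat \<Rightarrow> real) \<Rightarrow> nat" where
  "highest_diag M = Max (insert 0 {d. 1 \<le> d \<and> (\<exists>r\<ge>1. M r (r + d) \<noteq> 0)})"

definition hh ::
    "('n \<Rightarrow> 'n \<Rightarrow> nat) \<Rightarrow> ('n \<Rightarrow> 'n \<Rightarrow> nat) \<Rightarrow> nat \<Rightarrow>
     ('n \<Rightarrow> 'n \<Rightarrow> nat \<Rightarrow> nat \<Rightarrow> real) \<Rightarrow> 'n \<Rightarrow> 'n \<Rightarrow> nat" where
  "hh a b N \<kappa> i j = highest_diag (Lam a b N \<kappa> i j)"

definition hmax ::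
    "('n::finite \<Rightarrow> 'n \<Rightarrow> nat) \<Rightarrow> ('n \<Rightarrow> 'n \<Rightarrow> nat) \<Rightarrow> nat \<Rightarrow>
     ('n \<Rightarrow> 'n \<Rightarrow> nat \<Rightarrow> nat \<Rightarrow> real) \<Rightarrow> 'n \<Rightarrow> nat" where
  "hmax a b N \<kappa> i = Max (range (\<lambda>j. hh a b N \<kappa> i j))"

text \<open>The subtraction does not truncate, since \<open>hh a b N \<kappa> i j \<le> hmax a b N \<kappa> i\<close>.\<close>
definition tri ::
    "('n::finite \<Rightarrow> 'n \<Rightarrow> nat) \<Rightarrow> ('n \<Rightarrow> 'n \<Rightarrow> nat) \<Rightarrow> nat \<Rightarrow>
     ('n \<Rightarrow> 'n \<Rightarrow> nat \<Rightarrow> nat \<Rightarrow> real) \<Rightarrow> 'n \<Rightarrow> nat" where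
  "tri a b N \<kappa> j = Min (range (\<lambda>i. hmax a b N \<kappa> i - hh a b N \<kappa> i j))"

definition undef_idx ::
    "('n::finite \<Rightarrow> 'n \<Rightarrow> nat) \<Rightarrow> ('n \<Rightarrow> 'n \<Rightarrow> nat) \<Rightarrow> nat \<Rightarrow>
     ('n \<Rightarrow> 'n \<Rightarrow> nat \<Rightarrow> nat \<Rightarrow> real) \<Rightarrow> 'n \<Rightarrow> nat set" where
  "undef_idx a b N \<kappa> i = {..<hmax a b N \<kappa> i}"

definition Pmat ::
    "('n::finite \<Rightarrow> 'n \<Rightarrow> nat) \<Rightarrow> ('n \<Rightarrow> 'n \<Rightarrow> nat) \<Rightarrow> nat \<Rightarrow>
     ('n \<Rightarrow> 'n \<Rightarrow> nat \<Rightarrow> nat \<Rightarrow> real) \<Rightarrow> nat \<Rightarrow> real ^ 'n ^ 'n" where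
  "Pmat a b N \<kappa> r =
     (\<chi> v i. LamT a b N \<kappa> v i (r + tri a b N \<kappa> i + 1) (r + hmax a b N \<kappa> v + 1))"

definition Dmat ::
    "('n::finite \<Rightarrow> 'n \<Rightarrow> nat) \<Rightarrow> ('n \<Rightarrow> 'n \<Rightarrow> nat) \<Rightarrow> nat \<Rightarrow>
     ('n \<Rightarrow> 'n \<Rightarrow> nat \<Rightarrow> nat \<Rightarrow> real) \<Rightarrow> nat \<Rightarrow> real ^ 'n ^ 'n" where
  "Dmat a b N \<kappa> r = matrix_inv (Pmat a b N \<kappa> r)"

text \<open>
  \<open>Qpoly a b N \<kappa> j m\<close> and \<open>Rpoly a b N \<kappa> j m\<close> have upper index \<open>m\<close>; the recursive case is
  \<open>m = hmax a b N \<kappa> j + r\<close>. The recursion is well-founded because an index pair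
  \<open>(v, l - 1)\<close> on the right satisfies \<open>l - 1 < r + hmax a b N \<kappa> v\<close>.
\<close>
function Qpoly ::
    "('n::finite \<Rightarrow> 'n \<Rightarrow> nat) \<Rightarrow> ('n \<Rightarrow> 'n \<Rightarrow> nat) \<Rightarrow> nat \<Rightarrow>
     ('n \<Rightarrow> 'n \<Rightarrow> nat \<Rightarrow> nat \<Rightarrow> real) \<Rightarrow> 'n \<Rightarrow> nat \<Rightarrow> real \<Rightarrow> real ^ 'n" where
  "Qpoly a b N \<kappa> j m t =
     (if m \<in> undef_idx a b N \<kappa> j then 0
      else let r = m - hmax a b N \<kappa> j in
        \<Sum>i\<in>UNIV. Dmat a b N \<kappa> r $ i $ j *\<^sub>R
          (fpow b (r + tri a b N \<kappa> i) t *\<^sub>R axis i 1 -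
           (\<Sum>v\<in>UNIV. \<Sum>l = 1..r + hmax a b N \<kappa> v.
              LamT a b N \<kappa> v i (r + tri a b N \<kappa> i + 1) l *\<^sub>R Qpoly a b N \<kappa> v (l - 1) t)))"
  by pat_completeness auto
termination
  by (relation "Wellfounded.measure (\<lambda>(a, b, N, \<kappa>, j, m, t). Suc m - hmax a b N \<kappa> j)")
     (auto simp: undef_idx_def)

function Rpoly ::
    "('n::finite \<Rightarrow> 'n \<Rightarrow> nat) \<Rightarrow> ('n \<Rightarrow> 'n \<Rightarrow> nat) \<Rightarrow> nat \<Rightarrow>
     ('n \<Rightarrow> 'n \<Rightarrow> nat \<Rightarrow> nat \<Rightarrow> real) \<Rightarrow> 'n \<Rightarrow> nat \<Rightarrow> real \<Rightarrow> real ^ 'n" where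
  "Rpoly a b N \<kappa> j m t =
     (if m \<in> undef_idx a b N \<kappa> j then - (fpow b m t *\<^sub>R axis j 1)
      else let r = m - hmax a b N \<kappa> j in
        - (\<Sum>i\<in>UNIV. Dmat a b N \<kappa> r $ i $ j *\<^sub>R
            (\<Sum>v\<in>UNIV. \<Sum>l = 1..r + hmax a b N \<kappa> v.
               LamT a b N \<kappa> v i (r + tri a b N \<kappa> i + 1) l *\<^sub>R Rpoly a b N \<kappa> v (l - 1) t)))"
  by pat_completeness auto
termination
  by (relation "Wellfounded.measure (\<lambda>(a, b, N, \<kappa>, j, m, t). Suc m - hmax a b N \<kappa> j)")
     (auto simp: undef_idx_def)

declare Qpoly.simps [simp del] Rpoly.simps [simp del]

definition canonical_polynomial ::
    "('n::finite \<Rightarrow> 'n \<Rightarrow> nat) \<Rightarrow> ('n \<Rightarrow> 'n \<Rightarrow> nat) \<Rightarrow> nat \<Rightarrow>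
     ('n \<Rightarrow> 'n \<Rightarrow> nat \<Rightarrow> nat \<Rightarrow> real) \<Rightarrow> 'n \<Rightarrow> nat \<Rightarrow>
     (real \<Rightarrow> real ^ 'n) \<Rightarrow> (real \<Rightarrow> real ^ 'n) \<Rightarrow> bool" where
  "canonical_polynomial a b N \<kappa> i m Q R \<longleftrightarrow>
     m \<notin> undef_idx a b N \<kappa> i \<and> vector_polynomial b Q \<and> vector_polynomial b R \<and>
     (\<forall>t\<in>{0..1}. Lop a b N \<kappa> Q t = fpow b m t *\<^sub>R axis i 1 + R t)"

end

theory Submission
  imports Defs
begin

text \<open>
  By the Beta integral, \<open>L (t\<^bsup>m\<sigma>\<^esup> e\<^sub>i)\<close> has in component \<open>v\<close> the coefficients of row \<open>m + 1\<close> of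
  \<open>LamT v i\<close>. For \<open>m = r + tri i\<close> this row vanishes beyond column \<open>r + hmax v + 1\<close>, because
  \<open>tri i + hh v i \<le> hmax v\<close>, and its entry in that column is the \<open>(v, i)\<close> entry of \<open>Pmat r\<close>.
  Hence combining the images of these monomials with column \<open>j\<close> of the inverse of \<open>Pmat r\<close>
  isolates \<open>t\<^bsup>(hmax j + r)\<sigma>\<^esup> e\<^sub>j\<close> up to lower powers, which are replaced by images of earlier
  canonical polynomials at the cost of their residuals.
\<close>

section \<open>The Beta integral, finite sums and inverse matrices\<close>

text \<open>The substitution x = s / t turns this into the Beta integral on the unit interval.
  Powers are written as in \<open>fpow\<close>, so that the formula stays correct for
  \<open>n = 0\<close> at the origin.\<close>

lemma has_integral_Beta_scaled:
  fixes t \<alpha> \<sigma> :: real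
  assumes t: "0 \<le> t" and \<alpha>: "0 < \<alpha>" and \<sigma>: "0 < \<sigma>"
  shows "((\<lambda>s. (t - s) powr (\<alpha> - 1) * (s powr \<sigma>) ^ n) has_integral
           Beta \<alpha> (real n * \<sigma> + 1) * (t powr \<alpha> * (t powr \<sigma>) ^ n)) {0..t}"
proof (cases "t = 0")
  case True
  \<comment> \<open>The interval is degenerate, and the right side vanishes too because
    \<open>0 powr \<alpha> = 0\<close>.\<close>
  then show ?thesis using \<alpha> by (simp add: has_integral_refl)
next
  case False
  with t have t0: "t > 0" by simp
  define B where "B = Beta (real n * \<sigma> + 1) \<alpha>"
  have "((\<lambda>x. x powr (real n * \<sigma> + 1 - 1) * (1 - x) powr (\<alpha> - 1)) has_integral B) {0..1}"
    unfolding B_def using \<alpha> \<sigma> by (intro has_integral_Beta_real) (auto intro: add_nonneg_pos)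
  from has_integral_affinity'[OF this[folded cbox_interval], of "1 / t" 0] t0
  have "((\<lambda>x. (x / t) powr (real n * \<sigma>) * (1 - x / t) powr (\<alpha> - 1)) has_integral B * t) {0..t}"
    by (simp add: mult.commute)
  from has_integral_mult_right[OF this, of "t powr (\<alpha> - 1) * (t powr \<sigma>) ^ n"]
  have I: "((\<lambda>x. t powr (\<alpha> - 1) * (t powr \<sigma>) ^ n *
             ((x / t) powr (real n * \<sigma>) * (1 - x / t) powr (\<alpha> - 1))) has_integral
             t powr (\<alpha> - 1) * (t powr \<sigma>) ^ n * (B * t)) {0..t}" .
  have val: "t powr (\<alpha> - 1) * (t powr \<sigma>) ^ n * (B * t) =
      Beta \<alpha> (real n * \<sigma> + 1) * (t powr \<alpha> * (t powr \<sigma>) ^ n)"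
    using t0 by (simp add: B_def Beta_commute powr_diff)
  \<comment> \<open>The point 0 is left out because for \<open>n = 0\<close> the two integrands
    differ there: \<open>(0 powr \<sigma>) ^ 0\<close> is 1 while \<open>0 powr 0\<close> is 0. One
    point does not affect the integral.\<close>
  have eq: "(t - s) powr (\<alpha> - 1) * (s powr \<sigma>) ^ n =
      t powr (\<alpha> - 1) * (t powr \<sigma>) ^ n * ((s / t) powr (real n * \<sigma>) * (1 - s / t) powr (\<alpha> - 1))"
    if "s \<in> {0..t} - {0}" for s
  proof -
    from that have s: "0 < s" "s \<le> t" by auto
    have "t - s = t * (1 - s / t)" using t0 by (simp add: field_simps)
    then have "(t - s) powr (\<alpha> - 1) = t powr (\<alpha> - 1) * (1 - s / t) powr (\<alpha> - 1)"
      using t0 s by (simp add: powr_mult)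
    moreover have "(s powr \<sigma>) ^ n = (t powr \<sigma>) ^ n * (s / t) powr (real n * \<sigma>)"
      using t0 s by (simp add: powr_divide powr_powr mult.commute flip: powr_realpow)
    ultimately show ?thesis by simp
  qed
  show ?thesis
    using has_integral_spike_finite[OF _ eq I, of "{0}"] unfolding val by simp
qed

text \<open>Groups the kernel coefficients by antidiagonals p + q = v, which is how
  \<open>ktil\<close> collects them.\<close>

lemma sum_sum_by_total:
  fixes g :: "nat \<Rightarrow> nat \<Rightarrow> 'a::comm_monoid_add"
  shows "(\<Sum>p\<le>N. \<Sum>q\<le>N. g p q) = (\<Sum>v\<le>2 * N. \<Sum>(p, q)\<in>{(p, q). p \<le> N \<and> q \<le> N \<and> p + q = v}. g p q)"
proof -
  have "(\<Sum>p\<le>N. \<Sum>q\<le>N. g p q) = (\<Sum>x\<in>{..N} \<times> {..N}. case x of (p, q) \<Rightarrow> g p q)"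
    by (rule sum.cartesian_product)
  also have "\<dots> = (\<Sum>v\<le>2 * N. \<Sum>x\<in>{x\<in>{..N} \<times> {..N}. (case x of (p, q) \<Rightarrow> p + q) = v}. case x of (p, q) \<Rightarrow> g p q)"
    by (rule sum.group[symmetric]) auto
  also have "\<dots> = (\<Sum>v\<le>2 * N. \<Sum>(p, q)\<in>{(p, q). p \<le> N \<and> q \<le> N \<and> p + q = v}. g p q)"
    by (intro sum.cong refl) auto
  finally show ?thesis .
qed

lemma matrix_inv_right:
  fixes A :: "'a::semiring_1 ^ 'n ^ 'm"
  assumes "invertible A"
  shows "A ** matrix_inv A = mat 1"
  using assms unfolding invertible_def matrix_inv_def by (rule someI2_ex) simp

section \<open>The common denominator and the integer exponents\<close>

lemma gam_pos:
  fixes b :: "'n::finite \<Rightarrow> 'n \<Rightarrow> nat"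
  assumes "\<And>i j. 0 < b i j"
  shows "0 < gam b"
proof -
  have "{b i j | i j. True} = (\<lambda>(i, j). b i j) ` UNIV" by auto
  \<comment> \<open>Finiteness matters: the \<open>Lcm\<close> of an infinite set of naturals is 0.
    For a finite set it is 0 only if 0 is a member.\<close>
  then have "finite {b i j | i j. True}" by simp
  moreover have "0 \<notin> {b i j | i j. True}" using assms by (auto dest: sym)
  ultimately show ?thesis unfolding gam_def by (metis Lcm_0_iff_nat gr0I)
qed

lemma delta_eq:
  fixes b :: "'n::finite \<Rightarrow> 'n \<Rightarrow> nat"
  assumes "\<And>i j. 0 < b i j"
  shows "real (delta a b i j) * sig b = real (a i j) / real (b i j)"
proof -
  have "b i j dvd gam b" unfolding gam_def by (rule dvd_Lcm) auto
  then have "b i j dvd gam b * a i j" by simp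
  then have "real (delta a b i j) = real (gam b) * real (a i j) / real (b i j)"
    unfolding delta_def by (simp add: real_of_nat_div)
  then show ?thesis using gam_pos[of b] assms by (simp add: sig_def)
qed

lemma delta_pos:
  fixes a b :: "'n::finite \<Rightarrow> 'n \<Rightarrow> nat"
  assumes "\<And>i j. 0 < b i j" "0 < a i j"
  shows "0 < delta a b i j"
proof (rule gr0I)
  assume "delta a b i j = 0"
  with delta_eq[of b a i j] assms(1) have "real (a i j) / real (b i j) = 0" by simp
  with assms(1)[of i j] assms(2) show False by simp
qed

section \<open>Band structure of \<open>Lam\<close> and the index bounds\<close>

text \<open>\<open>Max\<close> bounds the members of a set only if the set is finite. This holds
  because \<open>Lam\<close> is supported on diagonals with index at most delta + 2N.\<close>

lemma Lam_above_hh: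
  assumes "1 \<le> r" "r + hh a b N \<kappa> i j < c"
  shows "Lam a b N \<kappa> i j r c = 0"
proof (rule ccontr)
  assume nz: "Lam a b N \<kappa> i j r c \<noteq> 0"
  define S where "S = {d. 1 \<le> d \<and> (\<exists>r\<ge>1. Lam a b N \<kappa> i j r (r + d) \<noteq> 0)}"
  have "S \<subseteq> {..delta a b i j + 2 * N}"
    unfolding S_def Lam_def by (auto split: if_splits)
  then have fin: "finite (insert 0 S)" by (simp add: finite_subset)
  have "c - r \<in> S" unfolding S_def using assms nz by auto
  then have "c - r \<le> hh a b N \<kappa> i j"
    unfolding hh_def highest_diag_def S_def[symmetric] using fin by (intro Max_ge) auto
  with assms show False by simp
qed

lemma tri_add_hh_le: "tri a b N \<kappa> j + hh a b N \<kappa> i j \<le> hmax a b N \<kappa> i"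
proof -
  have "tri a b N \<kappa> j \<le> hmax a b N \<kappa> i - hh a b N \<kappa> i j"
    unfolding tri_def by (rule Min_le) auto
  moreover have "hh a b N \<kappa> i j \<le> hmax a b N \<kappa> i"
    unfolding hmax_def by (rule Max_ge) auto
  ultimately show ?thesis by simp
qed

text \<open>Row \<open>m + 1\<close> can be cut off either by its formal band or by its highest
  nonzero diagonal, since entries lying in only one of the two ranges vanish. Column
  \<open>c\<close> stands for the power \<open>c - 1\<close>. The freedom in \<open>M\<close> is
  what later allows the sharp cutoff \<open>r + h v + 1\<close>.\<close>

lemma sum_Lam_eq:
  fixes a b :: "'n::finite \<Rightarrow> 'n \<Rightarrow> nat"
  assumes "0 < delta a b i j" and M: "m + 1 + hh a b N \<kappa> i j \<le> M"
  shows "(\<Sum>c = 1..M. Lam a b N \<kappa> i j (m + 1) c * f (c - 1)) =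
    (\<Sum>v\<le>2 * N. ktil a b N \<kappa> i j v m * f (delta a b i j + m + v))"
proof -
  let ?d = "delta a b i j + m + 1"
  have above: "Lam a b N \<kappa> i j (m + 1) c = 0" if "M < c" for c
    using M that by (intro Lam_above_hh) auto
  have outside: "Lam a b N \<kappa> i j (m + 1) c = 0" if "c \<notin> {?d..?d + 2 * N}" for c
    using that by (auto simp: Lam_def)
  have "(\<Sum>c = 1..M. Lam a b N \<kappa> i j (m + 1) c * f (c - 1)) =
      (\<Sum>c = ?d..?d + 2 * N. Lam a b N \<kappa> i j (m + 1) c * f (c - 1))"
    using assms(1) by (intro sum.mono_neutral_cong) (auto simp: above outside simp del: One_nat_def)
  also have "\<dots> = (\<Sum>v\<le>2 * N. Lam a b N \<kappa> i j (m + 1) (v + ?d) * f (v + ?d - 1))"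
    using sum.shift_bounds_cl_nat_ivl[of "\<lambda>c. Lam a b N \<kappa> i j (m + 1) c * f (c - 1)" 0 ?d "2 * N"]
    by (simp add: atLeast0AtMost add_ac)
  also have "\<dots> = (\<Sum>v\<le>2 * N. ktil a b N \<kappa> i j v m * f (delta a b i j + m + v))"
    by (intro sum.cong refl) (simp add: Lam_def add_ac)
  finally show ?thesis .
qed

section \<open>The integral operator on a single monomial\<close>

text \<open>Expanding the kernel leaves one Beta integral for each pair p, q, producing the power
  delta + m + p + q. Grouping by v = p + q yields row \<open>m + 1\<close> of
  \<open>Lam\<close>.\<close>

lemma has_integral_kernel_monomial:
  fixes a b :: "'n::finite \<Rightarrow> 'n \<Rightarrow> nat"
  assumes b: "\<And>i j. 0 < b i j" and a: "0 < a i j" and t: "0 \<le> t"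
    and M: "m + 1 + hh a b N \<kappa> i j \<le> M"
  shows "((\<lambda>s. (t - s) powr (real (a i j) / real (b i j) - 1) * ker b N \<kappa> i j t s * fpow b m s)
     has_integral (\<Sum>c = 1..M. Lam a b N \<kappa> i j (m + 1) c * fpow b (c - 1) t)) {0..t}"
proof -
  define \<alpha> where "\<alpha> = real (a i j) / real (b i j)"
  define d where "d = delta a b i j"
  have d: "\<alpha> = real d * sig b" unfolding \<alpha>_def d_def using delta_eq[of b a i j] b by simp
  have \<sigma>: "0 < sig b" using gam_pos[of b] b by (simp add: sig_def)
  have \<alpha>: "0 < \<alpha>" unfolding \<alpha>_def using a b by simp
  \<comment> \<open>At \<open>t = 0\<close> this relies on \<open>0 < d\<close>, since
    \<open>fpow b 0 0 = 1\<close> whereas \<open>0 powr \<alpha> = 0\<close>.\<close>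
  have pd: "t powr \<alpha> = fpow b d t"
    using t delta_pos[of b a i j] a b
    by (cases "t = 0") (auto simp: fpow_def d d_def powr_powr mult.commute simp flip: powr_realpow)
  have "((\<lambda>s. \<Sum>p\<le>N. \<Sum>q\<le>N. \<kappa> i j p q * fpow b p t *
           ((t - s) powr (\<alpha> - 1) * (s powr sig b) ^ (q + m))) has_integral
         (\<Sum>p\<le>N. \<Sum>q\<le>N. \<kappa> i j p q * fpow b p t *
           (Beta \<alpha> (real (q + m) * sig b + 1) * (t powr \<alpha> * (t powr sig b) ^ (q + m))))) {0..t}"
    by (intro has_integral_sum has_integral_mult_right has_integral_Beta_scaled t \<alpha> \<sigma> finite_atMost)
  moreover have "(\<lambda>s. \<Sum>p\<le>N. \<Sum>q\<le>N. \<kappa> i j p q * fpow b p t *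
           ((t - s) powr (\<alpha> - 1) * (s powr sig b) ^ (q + m))) =
      (\<lambda>s. (t - s) powr (\<alpha> - 1) * ker b N \<kappa> i j t s * fpow b m s)"
    by (simp add: ker_def fpow_def power_add sum_distrib_left sum_distrib_right mult_ac)
  moreover have "(\<Sum>p\<le>N. \<Sum>q\<le>N. \<kappa> i j p q * fpow b p t *
           (Beta \<alpha> (real (q + m) * sig b + 1) * (t powr \<alpha> * (t powr sig b) ^ (q + m)))) =
      (\<Sum>p\<le>N. \<Sum>q\<le>N. \<kappa> i j p q * Beta \<alpha> (real (q + m) * sig b + 1) * fpow b (d + m + (p + q)) t)"
    by (simp add: pd fpow_def power_add mult_ac)
  moreover have "\<dots> = (\<Sum>v\<le>2 * N. ktil a b N \<kappa> i j v m * fpow b (d + m + v) t)"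
    unfolding sum_sum_by_total ktil_def d_def[symmetric] d[symmetric] sum_distrib_right
    by (intro sum.cong refl) auto
  moreover have "\<dots> = (\<Sum>c = 1..M. Lam a b N \<kappa> i j (m + 1) c * fpow b (c - 1) t)"
    unfolding d_def using delta_pos[of b a i j] a b M by (intro sum_Lam_eq[symmetric]) auto
  ultimately show ?thesis unfolding \<alpha>_def by simp
qed

section \<open>A linear relation expressing L Y = Z\<close>

text \<open>
  Unlike \<open>Lop a b N \<kappa> Y = Z\<close>, this relation also records that the integral exists, which makes it
  closed under linear combinations.
\<close>
definition Lrel ::
    "('n::finite \<Rightarrow> 'n \<Rightarrow> nat) \<Rightarrow> ('n \<Rightarrow> 'n \<Rightarrow> nat) \<Rightarrow> nat \<Rightarrow>
     ('n \<Rightarrow> 'n \<Rightarrow> nat \<Rightarrow> nat \<Rightarrow> real) \<Rightarrow> (real \<Rightarrow> real ^ 'n) \<Rightarrow> (real \<Rightarrow> real ^ 'n) \<Rightarrow> bool" where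
  "Lrel a b N \<kappa> Y Z \<longleftrightarrow>
     (\<forall>t\<in>{0..1}. ((\<lambda>s. Kmat a b N \<kappa> t s *v Y s) has_integral (Y t - Z t)) {0..t})"

lemma Lrel_imp_Lop: "Lrel a b N \<kappa> Y Z \<Longrightarrow> t \<in> {0..1} \<Longrightarrow> Lop a b N \<kappa> Y t = Z t"
  unfolding Lrel_def Lop_def by (auto dest!: bspec integral_unique)

lemma Lrel_zero: "Lrel a b N \<kappa> (\<lambda>_. 0) (\<lambda>_. 0)"
  by (simp add: Lrel_def)

lemma Lrel_add:
  assumes "Lrel a b N \<kappa> Y Z" "Lrel a b N \<kappa> Y' Z'"
  shows "Lrel a b N \<kappa> (\<lambda>t. Y t + Y' t) (\<lambda>t. Z t + Z' t)"
  unfolding Lrel_def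
proof
  fix t :: real assume "t \<in> {0..1}"
  with assms have "((\<lambda>s. Kmat a b N \<kappa> t s *v Y s + Kmat a b N \<kappa> t s *v Y' s)
      has_integral (Y t - Z t) + (Y' t - Z' t)) {0..t}"
    unfolding Lrel_def by (intro has_integral_add) auto
  then show "((\<lambda>s. Kmat a b N \<kappa> t s *v (Y s + Y' s)) has_integral
      (Y t + Y' t - (Z t + Z' t))) {0..t}"
    by (simp add: matrix_vector_right_distrib algebra_simps)
qed

lemma Lrel_scaleR:
  assumes "Lrel a b N \<kappa> Y Z"
  shows "Lrel a b N \<kappa> (\<lambda>t. c *\<^sub>R Y t) (\<lambda>t. c *\<^sub>R Z t)"
  unfolding Lrel_def
proof
  fix t :: real assume "t \<in> {0..1}"
  with assms have "((\<lambda>s. c *\<^sub>R (Kmat a b N \<kappa> t s *v Y s)) has_integral c *\<^sub>R (Y t - Z t)) {0..t}"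
    unfolding Lrel_def by (intro has_integral_cmul) auto
  then show "((\<lambda>s. Kmat a b N \<kappa> t s *v (c *\<^sub>R Y s)) has_integral (c *\<^sub>R Y t - c *\<^sub>R Z t)) {0..t}"
    by (simp add: matrix_vector_mult_scaleR scaleR_diff_right)
qed

lemma Lrel_diff:
  "Lrel a b N \<kappa> Y Z \<Longrightarrow> Lrel a b N \<kappa> Y' Z' \<Longrightarrow> Lrel a b N \<kappa> (\<lambda>t. Y t - Y' t) (\<lambda>t. Z t - Z' t)"
  using Lrel_add[OF _ Lrel_scaleR[of a b N \<kappa> Y' Z' "-1"], of Y Z] by simp

lemma Lrel_sum:
  assumes "finite I" "\<And>i. i \<in> I \<Longrightarrow> Lrel a b N \<kappa> (Y i) (Z i)"
  shows "Lrel a b N \<kappa> (\<lambda>t. \<Sum>i\<in>I. Y i t) (\<lambda>t. \<Sum>i\<in>I. Z i t)"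
  using assms by (induction I rule: finite_induct) (auto intro: Lrel_zero Lrel_add)

lemma has_integral_vec:
  fixes f :: "real \<Rightarrow> real ^ 'n"
  assumes "\<And>i. ((\<lambda>s. f s $ i) has_integral y $ i) S"
  shows "(f has_integral y) S"
  unfolding has_integral_componentwise_iff[of f]
  using assms by (auto simp: Basis_vec_def inner_axis)

text \<open>Column i of the matrix kernel sends the monomial to row \<open>m + 1\<close> of each
  \<open>Lam v i\<close>; the identity part of \<open>LamT i i\<close> restores the monomial itself.
  The cutoff \<open>M v\<close> may differ between components.\<close>

lemma Lrel_monomial:
  fixes a b :: "'n::finite \<Rightarrow> 'n \<Rightarrow> nat"
  assumes b: "\<And>i j. 0 < b i j" and a: "\<And>i j. 0 < a i j"
    and M: "\<And>v. m + 1 + hh a b N \<kappa> v i \<le> M v"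
  shows "Lrel a b N \<kappa> (\<lambda>t. fpow b m t *\<^sub>R axis i 1)
    (\<lambda>t. \<Sum>v\<in>UNIV. \<Sum>c = 1..M v. LamT a b N \<kappa> v i (m + 1) c *\<^sub>R (fpow b (c - 1) t *\<^sub>R axis v 1))"
  unfolding Lrel_def
proof (intro ballI has_integral_vec)
  fix t :: real and w :: 'n assume t: "t \<in> {0..1}"
  \<comment> \<open>The diagonal column \<open>m + 1\<close> must lie within the cutoff, otherwise
    the contribution of the identity matrix would be lost.\<close>
  have M1: "m + 1 \<in> {1..M v}" for v using M[of v] by auto
  have L: "(\<Sum>c = 1..M w. Lam a b N \<kappa> w i (m + 1) c * fpow b (c - 1) t) =
      (fpow b m t *\<^sub>R axis i 1 - (\<Sum>v\<in>UNIV. \<Sum>c = 1..M v.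
        LamT a b N \<kappa> v i (m + 1) c *\<^sub>R (fpow b (c - 1) t *\<^sub>R axis v 1))) $ w"
  proof -
    have "(\<Sum>v\<in>UNIV. \<Sum>c = 1..M v.
        LamT a b N \<kappa> v i (m + 1) c *\<^sub>R (fpow b (c - 1) t *\<^sub>R axis v (1::real))) $ w =
      (\<Sum>v\<in>UNIV. if v = w then \<Sum>c = 1..M v. LamT a b N \<kappa> v i (m + 1) c * fpow b (c - 1) t else 0)"
      unfolding sum_component by (intro sum.cong refl) (auto simp: axis_def)
    also have "\<dots> = (\<Sum>c = 1..M w. LamT a b N \<kappa> w i (m + 1) c * fpow b (c - 1) t)"
      by simp
    also have "\<dots> = (\<Sum>c = 1..M w. (if c = m + 1 then (if w = i then fpow b m t else 0) else 0)
        - Lam a b N \<kappa> w i (m + 1) c * fpow b (c - 1) t)"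
      by (intro sum.cong refl) (auto simp: LamT_def algebra_simps)
    also have "\<dots> = (if w = i then fpow b m t else 0)
        - (\<Sum>c = 1..M w. Lam a b N \<kappa> w i (m + 1) c * fpow b (c - 1) t)"
      using M1[of w] by (simp add: sum_subtractf)
    finally show ?thesis by (auto simp: axis_def)
  qed
  have K: "(Kmat a b N \<kappa> t s *v (fpow b m s *\<^sub>R axis i 1)) $ w =
      (t - s) powr (real (a w i) / real (b w i) - 1) * ker b N \<kappa> w i t s * fpow b m s" for s
    by (simp add: matrix_vector_mult_def Kmat_def axis_def if_distrib cong: if_cong)
  show "((\<lambda>s. (Kmat a b N \<kappa> t s *v (fpow b m s *\<^sub>R axis i 1)) $ w) has_integral
      (fpow b m t *\<^sub>R axis i 1 - (\<Sum>v\<in>UNIV. \<Sum>c = 1..M v.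
        LamT a b N \<kappa> v i (m + 1) c *\<^sub>R (fpow b (c - 1) t *\<^sub>R axis v 1))) $ w) {0..t}"
    unfolding K L[symmetric] using t by (intro has_integral_kernel_monomial a b M) auto
qed

section \<open>Closure properties of vector polynomials\<close>

lemma vector_polynomial_zero: "vector_polynomial b (\<lambda>_. 0)"
  unfolding vector_polynomial_def by (rule exI[of _ "\<lambda>_. 0"]) simp

lemma vector_polynomial_add:
  assumes "vector_polynomial b Y" "vector_polynomial b Z"
  shows "vector_polynomial b (\<lambda>t. Y t + Z t)"
proof -
  from assms obtain p q where "\<forall>t\<in>{0..1}. \<forall>i. Y t $ i = poly (p i) (t powr sig b)"
    "\<forall>t\<in>{0..1}. \<forall>i. Z t $ i = poly (q i) (t powr sig b)"
    unfolding vector_polynomial_def by blast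
  then show ?thesis
    unfolding vector_polynomial_def by (intro exI[of _ "\<lambda>i. p i + q i"]) simp
qed

lemma vector_polynomial_scaleR:
  assumes "vector_polynomial b Y"
  shows "vector_polynomial b (\<lambda>t. c *\<^sub>R Y t)"
proof -
  from assms obtain p where "\<forall>t\<in>{0..1}. \<forall>i. Y t $ i = poly (p i) (t powr sig b)"
    unfolding vector_polynomial_def by blast
  then show ?thesis
    unfolding vector_polynomial_def by (intro exI[of _ "\<lambda>i. smult c (p i)"]) simp
qed

lemma vector_polynomial_uminus: "vector_polynomial b Y \<Longrightarrow> vector_polynomial b (\<lambda>t. - Y t)"
  using vector_polynomial_scaleR[of b Y "-1"] by simp

lemma vector_polynomial_diff:
  "vector_polynomial b Y \<Longrightarrow> vector_polynomial b Z \<Longrightarrow> vector_polynomial b (\<lambda>t. Y t - Z t)"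
  using vector_polynomial_add[OF _ vector_polynomial_uminus, of b Y Z] by simp

lemma vector_polynomial_sum:
  assumes "finite I" "\<And>i. i \<in> I \<Longrightarrow> vector_polynomial b (Y i)"
  shows "vector_polynomial b (\<lambda>t. \<Sum>i\<in>I. Y i t)"
  using assms
  by (induction I rule: finite_induct) (auto intro: vector_polynomial_zero vector_polynomial_add)

lemma vector_polynomial_monomial: "vector_polynomial b (\<lambda>t. fpow b m t *\<^sub>R axis i 1)"
  unfolding vector_polynomial_def
  by (rule exI[of _ "\<lambda>v. if v = i then monom 1 m else 0"]) (auto simp: fpow_def axis_def poly_monom)

section \<open>Unfolding of the recursion and its induction principle\<close>

lemma Qpoly_below: "m < hmax a b N \<kappa> j \<Longrightarrow> Qpoly a b N \<kappa> j m = (\<lambda>_. 0)"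
  by (rule ext) (simp add: Qpoly.simps[of a b N \<kappa> j m] undef_idx_def)

lemma Rpoly_below: "m < hmax a b N \<kappa> j \<Longrightarrow> Rpoly a b N \<kappa> j m = (\<lambda>t. - (fpow b m t *\<^sub>R axis j 1))"
  by (rule ext) (simp add: Rpoly.simps[of a b N \<kappa> j m] undef_idx_def)

lemma Qpoly_rec:
  "Qpoly a b N \<kappa> j (hmax a b N \<kappa> j + r) =
    (\<lambda>t. \<Sum>i\<in>UNIV. Dmat a b N \<kappa> r $ i $ j *\<^sub>R
      (fpow b (r + tri a b N \<kappa> i) t *\<^sub>R axis i 1 -
       (\<Sum>v\<in>UNIV. \<Sum>l = 1..r + hmax a b N \<kappa> v.
          LamT a b N \<kappa> v i (r + tri a b N \<kappa> i + 1) l *\<^sub>R Qpoly a b N \<kappa> v (l - 1) t)))"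
  by (rule ext, subst Qpoly.simps) (simp add: undef_idx_def)

lemma Rpoly_rec:
  "Rpoly a b N \<kappa> j (hmax a b N \<kappa> j + r) =
    (\<lambda>t. - (\<Sum>i\<in>UNIV. Dmat a b N \<kappa> r $ i $ j *\<^sub>R
      (\<Sum>v\<in>UNIV. \<Sum>l = 1..r + hmax a b N \<kappa> v.
         LamT a b N \<kappa> v i (r + tri a b N \<kappa> i + 1) l *\<^sub>R Rpoly a b N \<kappa> v (l - 1) t)))"
  by (rule ext, subst Rpoly.simps) (simp add: undef_idx_def)

text \<open>Strong induction on the level r for all components at once. The level is the distance of
  the upper index from \<open>hmax\<close>, not the upper index itself, because the thresholds
  differ between components.\<close>

lemma recursion_index_induct:
  fixes a b :: "'n::finite \<Rightarrow> 'n \<Rightarrow> nat"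
  assumes below: "\<And>j m. m < hmax a b N \<kappa> j \<Longrightarrow> P j m"
    and step: "\<And>j r. (\<And>v l. l \<in> {1..r + hmax a b N \<kappa> v} \<Longrightarrow> P v (l - 1)) \<Longrightarrow> P j (hmax a b N \<kappa> j + r)"
  shows "P j m"
proof -
  have "P j (hmax a b N \<kappa> j + r)" for j r
  proof (induction r arbitrary: j rule: less_induct)
    case (less r)
    show ?case
    proof (rule step)
      fix v l assume l: "l \<in> {1..r + hmax a b N \<kappa> v}"
      show "P v (l - 1)"
      proof (cases "l - 1 < hmax a b N \<kappa> v")
        case True
        then show ?thesis by (rule below)
      next
        case False
        \<comment> \<open>From \<open>l - 1 < r + hmax a b N \<kappa> v\<close>, the level of the
          pair \<open>(v, l - 1)\<close> is strictly below r.\<close>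
        with l have "l - 1 - hmax a b N \<kappa> v < r" by auto
        from less[OF this, of v] have "P v (hmax a b N \<kappa> v + (l - 1 - hmax a b N \<kappa> v))" .
        moreover have "hmax a b N \<kappa> v + (l - 1 - hmax a b N \<kappa> v) = l - 1" using False by simp
        ultimately show ?thesis by (simp only:)
      qed
    qed
  qed
  from this[of j "m - hmax a b N \<kappa> j"] below[of m j] show ?thesis
    by (cases "m < hmax a b N \<kappa> j") auto
qed

lemma vector_polynomial_Qpoly: "vector_polynomial b (Qpoly a b N \<kappa> j m)"
proof (induction rule: recursion_index_induct[of a b N \<kappa>])
  case (1 j m)
  then show ?case by (simp add: Qpoly_below vector_polynomial_zero)
next
  case (2 j r)
  then show ?case unfolding Qpoly_rec
    by (intro vector_polynomial_sum vector_polynomial_scaleR vector_polynomial_diff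
        vector_polynomial_monomial finite finite_atLeastAtMost)
qed

lemma vector_polynomial_Rpoly: "vector_polynomial b (Rpoly a b N \<kappa> j m)"
proof (induction rule: recursion_index_induct[of a b N \<kappa>])
  case (1 j m)
  then show ?case
    by (simp add: Rpoly_below vector_polynomial_uminus vector_polynomial_monomial)
next
  case (2 j r)
  then show ?case unfolding Rpoly_rec
    by (intro vector_polynomial_sum vector_polynomial_scaleR vector_polynomial_uminus
        finite finite_atLeastAtMost)
qed

section \<open>The canonical identity for the recursively defined families\<close>

lemma Lrel_Qpoly:
  fixes a b :: "'n::finite \<Rightarrow> 'n \<Rightarrow> nat"
  assumes b: "\<And>i j. 0 < b i j" and a: "\<And>i j. 0 < a i j"
    and P: "\<And>r. invertible (Pmat a b N \<kappa> r)"
  shows "Lrel a b N \<kappa> (Qpoly a b N \<kappa> j m) (\<lambda>t. fpow b m t *\<^sub>R axis j 1 + Rpoly a b N \<kappa> j m t)"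
proof (induction j m rule: recursion_index_induct[of a b N \<kappa>])
  case (1 j m)
  \<comment> \<open>Below the threshold the residual cancels the monomial, so the claim is L 0 = 0.
    Thus the induction hypothesis also covers the undefined indices that occur in the
    recursion.\<close>
  then show ?case by (simp add: Qpoly_below Rpoly_below Lrel_zero)
next
  case (2 j r)
  define h where "h = hmax a b N \<kappa>"
  define D where "D i = Dmat a b N \<kappa> r $ i $ j" for i
  define m where "m i = r + tri a b N \<kappa> i" for i
  define T where "T v i c = LamT a b N \<kappa> v i (m i + 1) c" for v i c
  define X where "X v c t = fpow b c t *\<^sub>R (axis v 1 :: real ^ 'n)" for v c t
  have mono: "Lrel a b N \<kappa> (X i (m i)) (\<lambda>t. \<Sum>v\<in>UNIV. \<Sum>c = 1..r + h v + 1. T v i c *\<^sub>R X v (c - 1) t)"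
    for i
    unfolding X_def T_def
  proof (rule Lrel_monomial[OF b a])
    show "m i + 1 + hh a b N \<kappa> v i \<le> r + h v + 1" for v
      unfolding m_def h_def using tri_add_hh_le[of a b N \<kappa> i v] by simp
  qed
  \<comment> \<open>L is applied termwise to the right side of the recursion: \<open>mono\<close>
    handles the new monomials and the induction hypothesis the earlier polynomials.\<close>
  have "Lrel a b N \<kappa>
      (\<lambda>t. \<Sum>i\<in>UNIV. D i *\<^sub>R (X i (m i) t -
        (\<Sum>v\<in>UNIV. \<Sum>l = 1..r + h v. T v i l *\<^sub>R Qpoly a b N \<kappa> v (l - 1) t)))
      (\<lambda>t. \<Sum>i\<in>UNIV. D i *\<^sub>R ((\<Sum>v\<in>UNIV. \<Sum>c = 1..r + h v + 1. T v i c *\<^sub>R X v (c - 1) t) -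
        (\<Sum>v\<in>UNIV. \<Sum>l = 1..r + h v. T v i l *\<^sub>R (X v (l - 1) t + Rpoly a b N \<kappa> v (l - 1) t))))"
    using 2 unfolding X_def[symmetric] h_def[symmetric]
    by (intro Lrel_sum Lrel_scaleR Lrel_diff mono finite finite_atLeastAtMost)
  moreover have "(\<lambda>t. \<Sum>i\<in>UNIV. D i *\<^sub>R (X i (m i) t -
        (\<Sum>v\<in>UNIV. \<Sum>l = 1..r + h v. T v i l *\<^sub>R Qpoly a b N \<kappa> v (l - 1) t))) =
      Qpoly a b N \<kappa> j (h j + r)"
    unfolding Qpoly_rec h_def D_def T_def X_def m_def ..
  moreover have "(\<Sum>i\<in>UNIV. D i *\<^sub>R ((\<Sum>v\<in>UNIV. \<Sum>c = 1..r + h v + 1. T v i c *\<^sub>R X v (c - 1) t) -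
        (\<Sum>v\<in>UNIV. \<Sum>l = 1..r + h v. T v i l *\<^sub>R (X v (l - 1) t + Rpoly a b N \<kappa> v (l - 1) t)))) =
      X j (h j + r) t + Rpoly a b N \<kappa> j (h j + r) t" for t
  proof -
    let ?R = "\<lambda>i. \<Sum>v\<in>UNIV. \<Sum>l = 1..r + h v. T v i l *\<^sub>R Rpoly a b N \<kappa> v (l - 1) t"
    \<comment> \<open>This is entry \<open>(v, j)\<close> of the product of \<open>Pmat\<close> with
      its inverse, in that order: the sum runs over the column index \<open>i\<close> of
      \<open>Pmat\<close>.\<close>
    have inv: "(\<Sum>i\<in>UNIV. T v i (r + h v + 1) * D i) = (if v = j then 1 else 0)" for v
    proof -
      have "(Pmat a b N \<kappa> r ** Dmat a b N \<kappa> r) $ v $ j = (if v = j then 1 else 0)"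
        unfolding Dmat_def matrix_inv_right[OF P] by (simp add: mat_def)
      then show ?thesis
        by (simp add: matrix_matrix_mult_def Pmat_def T_def D_def m_def h_def)
    qed
    \<comment> \<open>The monomials in columns up to \<open>r + h v\<close> cancel. What survives is
      the last column, carrying the power \<open>h v + r\<close>, and the residuals.\<close>
    have "(\<Sum>v\<in>UNIV. \<Sum>c = 1..r + h v + 1. T v i c *\<^sub>R X v (c - 1) t) -
        (\<Sum>v\<in>UNIV. \<Sum>l = 1..r + h v. T v i l *\<^sub>R (X v (l - 1) t + Rpoly a b N \<kappa> v (l - 1) t)) =
        (\<Sum>v\<in>UNIV. T v i (r + h v + 1) *\<^sub>R X v (h v + r) t) - ?R i" for i
      by (simp add: sum.distrib scaleR_add_right sum_subtractf[symmetric] add.commute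
          del: sum_subtractf)
    then have "?thesis \<longleftrightarrow>
        (\<Sum>i\<in>UNIV. \<Sum>v\<in>UNIV. (T v i (r + h v + 1) * D i) *\<^sub>R X v (h v + r) t)
          - (\<Sum>i\<in>UNIV. D i *\<^sub>R ?R i) = X j (h j + r) t + Rpoly a b N \<kappa> j (h j + r) t"
      by (simp add: scaleR_diff_right sum_subtractf scaleR_sum_right mult.commute)
    \<comment> \<open>Exchanging the sums gathers the coefficient of each
      \<open>X v (h v + r)\<close>, which \<open>inv\<close> evaluates to 1 for \<open>v = j\<close>
      and 0 otherwise.\<close>
    moreover have "(\<Sum>i\<in>UNIV. \<Sum>v\<in>UNIV. (T v i (r + h v + 1) * D i) *\<^sub>R X v (h v + r) t) =
        (\<Sum>v\<in>UNIV. (\<Sum>i\<in>UNIV. T v i (r + h v + 1) * D i) *\<^sub>R X v (h v + r) t)"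
      unfolding scaleR_sum_left by (rule sum.swap)
    moreover have "\<dots> = X j (h j + r) t"
      unfolding inv by (simp add: if_distrib[of "\<lambda>x. x *\<^sub>R _"] cong: if_cong)
    moreover have "Rpoly a b N \<kappa> j (h j + r) t = - (\<Sum>i\<in>UNIV. D i *\<^sub>R ?R i)"
      unfolding Rpoly_rec h_def D_def T_def m_def ..
    ultimately show ?thesis by simp
  qed
  ultimately show ?case unfolding h_def X_def by simp
qed

theorem theorem4:
  fixes a b :: "'n::finite \<Rightarrow> 'n \<Rightarrow> nat"
    and N :: nat
    and \<kappa> :: "'n \<Rightarrow> 'n \<Rightarrow> nat \<Rightarrow> nat \<Rightarrow> real"
  assumes "\<And>i j. 0 < a i j" and "\<And>i j. a i j \<le> b i j" and "\<And>i j. coprime (a i j) (b i j)"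
    and "\<And>r. invertible (Pmat a b N \<kappa> r)"
  shows "\<forall>j r. canonical_polynomial a b N \<kappa> j (hmax a b N \<kappa> j + r)
           (Qpoly a b N \<kappa> j (hmax a b N \<kappa> j + r)) (Rpoly a b N \<kappa> j (hmax a b N \<kappa> j + r))"
proof (intro allI)
  fix j r
  have "0 < b i j" for i j using assms(1,2)[of i j] by simp
  from Lrel_Qpoly[OF this assms(1,4)]
  have "Lop a b N \<kappa> (Qpoly a b N \<kappa> j m) t = fpow b m t *\<^sub>R axis j 1 + Rpoly a b N \<kappa> j m t"
    if "t \<in> {0..1}" for m t
    using Lrel_imp_Lop that by blast
  then show "canonical_polynomial a b N \<kappa> j (hmax a b N \<kappa> j + r)
           (Qpoly a b N \<kappa> j (hmax a b N \<kappa> j + r)) (Rpoly a b N \<kappa> j (hmax a b N \<kappa> j + r))"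
    by (simp add: canonical_polynomial_def undef_idx_def vector_polynomial_Qpoly
        vector_polynomial_Rpoly)
qed

end
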